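(* $A_{0}+AP_{+}$ is not coherent.
   Context: $\mathbb{C}_{\geq 0}=\{s\in\mathbb{C}:\operatorname{Re}(s)\geq 0\}$ and $\mathbb{C}_{>0}=\{s\in\mathbb{C}:\operatorname{Re}(s)>0\}$. $A_{0}$ is the set of functions $f:\mathbb{C}_{\geq 0}\to\mathbb{C}$ that are holomorphic in $\mathbb{C}_{>0}$, continuous on $\mathbb{C}_{\geq 0}$, and satisfy $\lim_{s\to\infty}f(s)=0$ (limit as $|s|\to\infty$ in $\mathbb{C}_{\geq 0}$). $AP_{+}$ (causal almost periodic functions) is the closure, in the supremum norm on $\mathbb{C}_{\geq 0}$, of the complex linear span of the functions $s\mapsto e^{-st}$, $t\geq 0$. $A_{0}+AP_{+}=\{f:\mathbb{C}_{\geq 0}\to\mathbb{C}: f=f_{A_0}+f_{AP_+},\ f_{A_0}\in A_0,\ f_{AP_+}\in AP_+\}$ is a Banach algebra with pointwise operations and the supremum norm; it is an integral domain. An integral domain $R$ is called coherent if for any pair $(I,J)$ of finitely generated ideals in $R$, the intersection $I\cap J$ is finitely generated. *)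

theory Defs
  imports "HOL-Complex_Analysis.Complex_Analysis" "HOL-Algebra.Ideal"
begin

definition closed_rhp :: "complex set" where
  "closed_rhp = {s. Re s \<ge> 0}"

definition open_rhp :: "complex set" where
  "open_rhp = {s. Re s > 0}"

text \<open>
  A function from the closed right half-plane to the complex numbers is represented by its
  extensional extension (\<^const>\<open>undefined\<close> off the half-plane), so that two elements are equal iff
  they agree on the half-plane.
\<close>

definition A_zero :: "(complex \<Rightarrow> complex) set" where
  "A_zero = {f \<in> extensional closed_rhp.
     f holomorphic_on open_rhp \<and> continuous_on closed_rhp f \<and>
     (f \<longlongrightarrow> 0) (inf at_infinity (principal closed_rhp))}"

definition causal_exp_span :: "(complex \<Rightarrow> complex) set" where
  "causal_exp_span =
     {(\<lambda>s\<in>closed_rhp. \<Sum>t\<in>T. c t * exp (- s * of_real t)) |(c :: real \<Rightarrow> complex) T.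
        finite T \<and> T \<subseteq> {0..}}"

text \<open>
  \<^term>\<open>funspace S m\<close> is the metric space of bounded extensional functions on \<^term>\<open>S\<close> with the
  supremum metric.  Restricting to bounded functions loses nothing, since uniform limits of the
  (bounded) functions in the span are bounded; see \<open>AP_plus_iff\<close> below.
\<close>

definition AP_plus :: "(complex \<Rightarrow> complex) set" where
  "AP_plus =
     Abstract_Topology.closure_of (mtopology_of (funspace closed_rhp euclidean_metric)) causal_exp_span"

definition A_zero_AP_plus :: "(complex \<Rightarrow> complex) ring" where
  "A_zero_AP_plus =
     \<lparr>carrier = {(\<lambda>s\<in>closed_rhp. f s + g s) |f g. f \<in> A_zero \<and> g \<in> AP_plus},
      mult = (\<lambda>f g. \<lambda>s\<in>closed_rhp. f s * g s),
      one = (\<lambda>s\<in>closed_rhp. 1),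
      ring.zero = (\<lambda>s\<in>closed_rhp. 0),
      ring.add = (\<lambda>f g. \<lambda>s\<in>closed_rhp. f s + g s)\<rparr>"

definition fin_gen_ideal :: "'a set \<Rightarrow> ('a, 'b) ring_scheme \<Rightarrow> bool" where
  "fin_gen_ideal I R \<longleftrightarrow> ideal I R \<and> (\<exists>A\<subseteq>carrier R. finite A \<and> I = genideal R A)"

text \<open>
  Coherence is only of interest for integral domains.  That \<^term>\<open>R\<close> is a domain is deliberately not
  part of the predicate, so that its negation really asserts the existence of two finitely
  generated ideals whose intersection is not finitely generated.
\<close>

definition coherent_ring :: "('a, 'b) ring_scheme \<Rightarrow> bool" where
  "coherent_ring R \<longleftrightarrow>
     (\<forall>I J. fin_gen_ideal I R \<and> fin_gen_ideal J R \<longrightarrow> fin_gen_ideal (I \<inter> J) R)"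


subsection \<open>The algebra is an integral domain\<close>

lemma open_open_rhp: "open open_rhp"
  unfolding open_rhp_def by (rule open_halfspace_Re_gt)

lemma connected_open_rhp: "connected open_rhp"
  unfolding open_rhp_def by (intro convex_connected convex_halfspace_Re_gt)

lemma open_rhp_subset: "open_rhp \<subseteq> closed_rhp"
  by (auto simp: open_rhp_def closed_rhp_def)

lemma closed_rhp_subset_closure: "closed_rhp \<subseteq> closure open_rhp"
proof
  fix s assume s: "s \<in> closed_rhp"
  have "(\<lambda>n. s + of_real (inverse (real (Suc n)))) \<longlonglongrightarrow> s + of_real 0"
    by (intro tendsto_intros LIMSEQ_inverse_real_of_nat)
  moreover have "s + of_real (inverse (real (Suc n))) \<in> open_rhp" for n
    using s by (auto simp: open_rhp_def closed_rhp_def add_nonneg_pos)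
  ultimately show "s \<in> closure open_rhp"
    unfolding closure_sequential
    by (intro exI[of _ "\<lambda>n. s + of_real (inverse (real (Suc n)))"]) simp
qed

lemma norm_exp_le: "s \<in> closed_rhp \<Longrightarrow> t \<ge> 0 \<Longrightarrow> norm (exp (- s * of_real t)) \<le> 1"
  by (simp add: norm_exp_eq_Re closed_rhp_def)

lemma causal_exp_spanI:
  assumes "finite I" "\<And>i. i \<in> I \<Longrightarrow> \<tau> i \<ge> (0::real)"
    and "p = (\<lambda>s\<in>closed_rhp. \<Sum>i\<in>I. c i * exp (- s * of_real (\<tau> i)))"
  shows "p \<in> causal_exp_span"
proof -
  define d where "d t = (\<Sum>i\<in>{i\<in>I. \<tau> i = t}. c i)" for t
  have "(\<Sum>i\<in>I. c i * exp (- s * of_real (\<tau> i))) =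
        (\<Sum>t\<in>\<tau> ` I. d t * exp (- s * of_real t))" for s
    unfolding d_def sum_distrib_right
    by (subst sum.image_gen[OF assms(1), where g = \<tau>]) (intro sum.cong, auto)
  then have "p = (\<lambda>s\<in>closed_rhp. \<Sum>t\<in>\<tau> ` I. d t * exp (- s * of_real t))"
    by (simp add: assms(3))
  then show ?thesis
    unfolding causal_exp_span_def using assms by blast
qed

lemma causal_exp_spanE:
  assumes "p \<in> causal_exp_span"
  obtains c T where "finite T" "T \<subseteq> {0::real..}"
    "p = (\<lambda>s\<in>closed_rhp. \<Sum>t\<in>T. c t * exp (- s * of_real t))"
  using assms unfolding causal_exp_span_def by blast

lemma causal_exp_span_bounded:
  assumes "p \<in> causal_exp_span"
  obtains B where "B > 0" "\<And>s. s \<in> closed_rhp \<Longrightarrow> norm (p s) \<le> B"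
proof -
  obtain c T where *: "finite T" "T \<subseteq> {0::real..}"
    "p = (\<lambda>s\<in>closed_rhp. \<Sum>t\<in>T. c t * exp (- s * of_real t))"
    by (rule causal_exp_spanE[OF assms])
  have "norm (p s) \<le> 1 + (\<Sum>t\<in>T. norm (c t))" if "s \<in> closed_rhp" for s
  proof -
    have "norm (p s) \<le> (\<Sum>t\<in>T. norm (c t))"
      unfolding *(3) restrict_apply'[OF that]
    proof (rule sum_norm_le)
      fix t assume "t \<in> T"
      then have "norm (exp (- s * of_real t)) \<le> 1"
        using norm_exp_le[OF that] *(2) by auto
      then show "norm (c t * exp (- s * of_real t)) \<le> norm (c t)"
        unfolding norm_mult by (simp add: mult_left_le del: norm_exp_eq_Re)
    qed
    then show ?thesis by simp
  qed
  moreover have "1 + (\<Sum>t\<in>T. norm (c t)) > 0"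
    by (simp add: add_pos_nonneg sum_nonneg)
  ultimately show ?thesis using that by blast
qed

lemma causal_exp_span_analytic:
  assumes "p \<in> causal_exp_span"
  shows "p holomorphic_on open_rhp" "continuous_on closed_rhp p"
proof -
  obtain c T where *: "finite T" "T \<subseteq> {0::real..}"
    "p = (\<lambda>s\<in>closed_rhp. \<Sum>t\<in>T. c t * exp (- s * of_real t))"
    by (rule causal_exp_spanE[OF assms])
  have "(\<lambda>s. \<Sum>t\<in>T. c t * exp (- s * of_real t)) holomorphic_on open_rhp"
    by (intro holomorphic_intros)
  then show "p holomorphic_on open_rhp"
    by (rule holomorphic_transform) (use open_rhp_subset in \<open>auto simp: *(3)\<close>)
  have "continuous_on closed_rhp (\<lambda>s. \<Sum>t\<in>T. c t * exp (- s * of_real t))"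
    by (intro continuous_intros)
  then show "continuous_on closed_rhp p"
    by (rule continuous_on_eq) (simp add: *(3))
qed

lemma causal_exp_span_const: "(\<lambda>s\<in>closed_rhp. a) \<in> causal_exp_span"
  by (rule causal_exp_spanI[of "{0::real}" "\<lambda>x. x" _ "\<lambda>_. a"]) auto

lemma causal_exp_span_add:
  assumes "p \<in> causal_exp_span" "q \<in> causal_exp_span"
  shows "(\<lambda>s\<in>closed_rhp. p s + q s) \<in> causal_exp_span"
proof -
  obtain c T where 1: "finite T" "T \<subseteq> {0::real..}"
    "p = (\<lambda>s\<in>closed_rhp. \<Sum>t\<in>T. c t * exp (- s * of_real t))"
    by (rule causal_exp_spanE[OF assms(1)])
  obtain d U where 2: "finite U" "U \<subseteq> {0::real..}"
    "q = (\<lambda>s\<in>closed_rhp. \<Sum>t\<in>U. d t * exp (- s * of_real t))"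
    by (rule causal_exp_spanE[OF assms(2)])
  show ?thesis
  proof (rule causal_exp_spanI[of "T <+> U" "case_sum (\<lambda>x. x) (\<lambda>x. x)" _ "case_sum c d"])
    show "(\<lambda>s\<in>closed_rhp. p s + q s) =
      (\<lambda>s\<in>closed_rhp. \<Sum>i\<in>T <+> U. case_sum c d i *
         exp (- s * of_real (case_sum (\<lambda>x. x) (\<lambda>x. x) i)))"
      using 1 2 by (auto simp: fun_eq_iff sum.Plus restrict_def)
  qed (use 1 2 in auto)
qed

lemma causal_exp_span_mult:
  assumes "p \<in> causal_exp_span" "q \<in> causal_exp_span"
  shows "(\<lambda>s\<in>closed_rhp. p s * q s) \<in> causal_exp_span"
proof -
  obtain c T where 1: "finite T" "T \<subseteq> {0::real..}"
    "p = (\<lambda>s\<in>closed_rhp. \<Sum>t\<in>T. c t * exp (- s * of_real t))"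
    by (rule causal_exp_spanE[OF assms(1)])
  obtain d U where 2: "finite U" "U \<subseteq> {0::real..}"
    "q = (\<lambda>s\<in>closed_rhp. \<Sum>t\<in>U. d t * exp (- s * of_real t))"
    by (rule causal_exp_spanE[OF assms(2)])
  show ?thesis
  proof (rule causal_exp_spanI[of "T \<times> U" "\<lambda>(t,u). t + u" _ "\<lambda>(t,u). c t * d u"])
    show "(\<lambda>s\<in>closed_rhp. p s * q s) =
      (\<lambda>s\<in>closed_rhp. \<Sum>i\<in>T \<times> U. (case i of (t,u) \<Rightarrow> c t * d u) *
         exp (- s * of_real (case i of (t,u) \<Rightarrow> t + u)))"
      using 1 2
      by (auto simp: fun_eq_iff restrict_def sum_product sum.cartesian_product split_beta
            exp_add[symmetric] algebra_simps intro!: sum.cong)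
  qed (use 1 2 in \<open>auto intro!: add_nonneg_nonneg\<close>)
qed

lemma AP_plus_iff:
  "f \<in> AP_plus \<longleftrightarrow> f \<in> extensional closed_rhp \<and>
     (\<forall>e>0. \<exists>p\<in>causal_exp_span. \<forall>s\<in>closed_rhp. norm (f s - p s) \<le> e)"
proof -
  let ?F = "Metric_space.fspace UNIV dist closed_rhp :: (complex \<Rightarrow> complex) set"
  let ?d = "Metric_space.fdist UNIV dist closed_rhp :: _ \<Rightarrow> (complex \<Rightarrow> complex) \<Rightarrow> _"
  have F: "g \<in> ?F \<longleftrightarrow> g \<in> extensional closed_rhp \<and> bounded (g ` closed_rhp)" for g
    by (simp add: Met_TC.fspace_def)
  have ne: "closed_rhp \<noteq> {}" unfolding closed_rhp_def by (auto intro: exI[of _ 0])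
  have sub: "causal_exp_span \<subseteq> ?F"
  proof
    fix p assume p: "p \<in> causal_exp_span"
    then have "bounded (p ` closed_rhp)"
      by (metis causal_exp_span_bounded bounded_iff image_iff)
    moreover have "p \<in> extensional closed_rhp"
      by (rule causal_exp_spanE[OF p]) simp
    ultimately show "p \<in> ?F" using F by blast
  qed
  interpret S: Metric_space ?F ?d
    by (rule Met_TC.Metric_space_funspace)
  have AP: "AP_plus = Abstract_Topology.closure_of S.mtopology causal_exp_span"
    by (simp add: AP_plus_def mtopology_of_def)
  have eq: "f \<in> AP_plus \<longleftrightarrow> f \<in> ?F \<and> (\<forall>e>0. \<exists>p\<in>causal_exp_span. ?d f p \<le> e)"
    unfolding AP S.metric_closure_of_alt S.in_mcball mem_Collect_eq using sub by blast
  have d: "?d f p \<le> e \<longleftrightarrow> (\<forall>s\<in>closed_rhp. norm (f s - p s) \<le> e)"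
    if "f \<in> ?F" "p \<in> causal_exp_span" for p e
    using Met_TC.funspace_mdist_le[OF that(1) _ ne] sub that by (auto simp: dist_norm)
  have bd: "bounded (f ` closed_rhp)"
    if H: "\<forall>e>0. \<exists>p\<in>causal_exp_span. \<forall>s\<in>closed_rhp. norm (f s - p s) \<le> e"
  proof -
    obtain p where p: "p \<in> causal_exp_span" "\<forall>s\<in>closed_rhp. norm (f s - p s) \<le> 1"
      using H zero_less_one[where 'a=real] by blast
    obtain B where "B > 0" "\<And>s. s \<in> closed_rhp \<Longrightarrow> norm (p s) \<le> B"
      using causal_exp_span_bounded[OF p(1)] by blast
    then have "norm (f s) \<le> 1 + B" if "s \<in> closed_rhp" for s
      using p(2) that by (smt (verit) norm_triangle_sub)
    then show ?thesis by (auto simp: bounded_iff)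
  qed
  show ?thesis
    unfolding eq using d F bd by (metis (no_types, lifting))
qed

lemma causal_exp_span_imp_AP_plus: "p \<in> causal_exp_span \<Longrightarrow> p \<in> AP_plus"
  unfolding AP_plus_iff
  by (auto elim!: causal_exp_spanE intro!: bexI[of _ p]) (auto simp: causal_exp_span_def)

lemma AP_plus_bounded:
  assumes "f \<in> AP_plus"
  obtains B where "B > 0" "\<And>s. s \<in> closed_rhp \<Longrightarrow> norm (f s) \<le> B"
proof -
  obtain p where p: "p \<in> causal_exp_span" "\<forall>s\<in>closed_rhp. norm (f s - p s) \<le> 1"
    using assms zero_less_one[where 'a=real] unfolding AP_plus_iff by blast
  obtain B where "B > 0" "\<And>s. s \<in> closed_rhp \<Longrightarrow> norm (p s) \<le> B"
    using causal_exp_span_bounded[OF p(1)] by blast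
  then have "norm (f s) \<le> 1 + B" if "s \<in> closed_rhp" for s
    using p(2) that by (smt (verit) norm_triangle_sub)
  then show ?thesis using that[of "1 + B"] \<open>B > 0\<close> by auto
qed

lemma AP_plus_analytic:
  assumes "f \<in> AP_plus"
  shows "f holomorphic_on open_rhp" "continuous_on closed_rhp f"
proof -
  have "\<exists>p\<in>causal_exp_span. \<forall>s\<in>closed_rhp. norm (f s - p s) \<le> inverse (real (Suc n))" for n
    using assms unfolding AP_plus_iff by (simp del: of_nat_Suc)
  then obtain P where P: "\<And>n. P n \<in> causal_exp_span"
    "\<And>n s. s \<in> closed_rhp \<Longrightarrow> norm (f s - P n s) \<le> inverse (real (Suc n))"
    by metis
  have lim: "uniform_limit closed_rhp P f sequentially"
    unfolding uniform_limit_iff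
  proof (intro allI impI)
    fix e :: real assume "e > 0"
    then have "eventually (\<lambda>n. inverse (real (Suc n)) < e) sequentially"
      using LIMSEQ_inverse_real_of_nat order_tendstoD(2) by blast
    then show "\<forall>\<^sub>F n in sequentially. \<forall>x\<in>closed_rhp. dist (P n x) (f x) < e"
      by eventually_elim (metis P(2) dist_commute dist_norm le_less_trans)
  qed
  show "continuous_on closed_rhp f"
    by (rule uniform_limit_theorem[OF _ lim])
       (auto simp: causal_exp_span_analytic P)
  show "f holomorphic_on open_rhp"
  proof (rule holomorphic_uniform_sequence[OF open_open_rhp])
    show "P n holomorphic_on open_rhp" for n
      by (simp add: causal_exp_span_analytic P)
    show "\<exists>d>0. cball x d \<subseteq> open_rhp \<and> uniform_limit (cball x d) P f sequentially"
      if "x \<in> open_rhp" for x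
      using that open_open_rhp open_rhp_subset uniform_limit_on_subset[OF lim]
      by (meson open_contains_cball order_trans)
  qed
qed

lemma AP_plus_add:
  assumes "f \<in> AP_plus" "g \<in> AP_plus"
  shows "(\<lambda>s\<in>closed_rhp. f s + g s) \<in> AP_plus"
  unfolding AP_plus_iff
proof (intro conjI allI impI)
  fix e :: real assume "e > 0"
  then have "e / 2 > 0" by simp
  then obtain p q where pq: "p \<in> causal_exp_span" "\<forall>s\<in>closed_rhp. norm (f s - p s) \<le> e / 2"
    "q \<in> causal_exp_span" "\<forall>s\<in>closed_rhp. norm (g s - q s) \<le> e / 2"
    using assms unfolding AP_plus_iff by meson
  have "norm ((f s + g s) - (p s + q s)) \<le> e" if "s \<in> closed_rhp" for s
    using pq that norm_diff_triangle_ineq[of "f s" "g s" "p s" "q s"] by fastforce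
  then show "\<exists>r\<in>causal_exp_span. \<forall>s\<in>closed_rhp.
      norm ((\<lambda>s\<in>closed_rhp. f s + g s) s - r s) \<le> e"
    using causal_exp_span_add[OF pq(1,3)] by (intro bexI) auto
qed auto

lemma AP_plus_mult:
  assumes "f \<in> AP_plus" "g \<in> AP_plus"
  shows "(\<lambda>s\<in>closed_rhp. f s * g s) \<in> AP_plus"
  unfolding AP_plus_iff
proof (intro conjI allI impI)
  fix e :: real assume e: "e > 0"
  obtain B where B: "B > 0" "\<And>s. s \<in> closed_rhp \<Longrightarrow> norm (g s) \<le> B"
    using AP_plus_bounded[OF assms(2)] by blast
  from e B have "e / 2 / B > 0" by simp
  then obtain p where p: "p \<in> causal_exp_span" "\<forall>s\<in>closed_rhp. norm (f s - p s) \<le> e / 2 / B"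
    using assms(1) unfolding AP_plus_iff by meson
  obtain C where C: "C > 0" "\<And>s. s \<in> closed_rhp \<Longrightarrow> norm (p s) \<le> C"
    using causal_exp_span_bounded[OF p(1)] by blast
  from e C have "e / 2 / C > 0" by simp
  then obtain q where q: "q \<in> causal_exp_span" "\<forall>s\<in>closed_rhp. norm (g s - q s) \<le> e / 2 / C"
    using assms(2) unfolding AP_plus_iff by meson
  have "norm (f s * g s - p s * q s) \<le> e" if s: "s \<in> closed_rhp" for s
  proof -
    have "f s * g s - p s * q s = (f s - p s) * g s + p s * (g s - q s)"
      by (simp add: algebra_simps)
    also have "norm \<dots> \<le> norm (f s - p s) * norm (g s) + norm (p s) * norm (g s - q s)"
      by (metis norm_mult norm_triangle_ineq)
    also have "\<dots> \<le> (e / 2 / B) * B + C * (e / 2 / C)"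
      using p q B C s e by (intro add_mono mult_mono) auto
    also have "\<dots> = e" using B C by simp
    finally show ?thesis .
  qed
  then show "\<exists>r\<in>causal_exp_span. \<forall>s\<in>closed_rhp.
      norm ((\<lambda>s\<in>closed_rhp. f s * g s) s - r s) \<le> e"
    using causal_exp_span_mult[OF p(1) q(1)] by (intro bexI) auto
qed auto

lemma A_zeroI:
  assumes "h holomorphic_on open_rhp" "continuous_on closed_rhp h"
    "(h \<longlongrightarrow> 0) (inf at_infinity (principal closed_rhp))"
  shows "restrict h closed_rhp \<in> A_zero"
proof -
  have "restrict h closed_rhp holomorphic_on open_rhp"
    using assms(1) by (rule holomorphic_transform) (use open_rhp_subset in auto)
  moreover have "continuous_on closed_rhp (restrict h closed_rhp)"
    using assms(2) by (rule continuous_on_eq) simp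
  moreover have "(restrict h closed_rhp \<longlongrightarrow> 0) (inf at_infinity (principal closed_rhp))"
    using assms(3) by (rule Lim_transform_eventually) (simp add: eventually_inf_principal)
  ultimately show ?thesis by (simp add: A_zero_def)
qed

lemma A_zeroD:
  assumes "f \<in> A_zero"
  shows "f holomorphic_on open_rhp" "continuous_on closed_rhp f"
    "(f \<longlongrightarrow> 0) (inf at_infinity (principal closed_rhp))"
  using assms by (auto simp: A_zero_def)

lemma A_zero_add:
  assumes "f \<in> A_zero" "g \<in> A_zero"
  shows "(\<lambda>s\<in>closed_rhp. f s + g s) \<in> A_zero"
  using A_zeroD[OF assms(1)] A_zeroD[OF assms(2)]
  by (intro A_zeroI holomorphic_intros continuous_intros tendsto_add_zero)

lemma A_zero_mult:
  assumes "f \<in> A_zero" "g \<in> A_zero"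
  shows "(\<lambda>s\<in>closed_rhp. f s * g s) \<in> A_zero"
  using A_zeroD[OF assms(1)] A_zeroD[OF assms(2)]
  by (intro A_zeroI holomorphic_intros continuous_intros tendsto_mult_zero)

lemma A_zero_mult_AP_plus:
  assumes "f \<in> A_zero" "g \<in> AP_plus"
  shows "(\<lambda>s\<in>closed_rhp. f s * g s) \<in> A_zero"
proof -
  obtain B where B: "B > 0" "\<And>s. s \<in> closed_rhp \<Longrightarrow> norm (g s) \<le> B"
    using AP_plus_bounded[OF assms(2)] by blast
  let ?F = "inf at_infinity (principal closed_rhp)"
  have "((\<lambda>s. f s * g s) \<longlongrightarrow> 0) ?F"
  proof (rule Lim_null_comparison)
    show "\<forall>\<^sub>F s in ?F. norm (f s * g s) \<le> norm (f s) * B"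
      unfolding eventually_inf_principal
      by (intro always_eventually) (auto simp: norm_mult B mult_left_mono)
    show "((\<lambda>s. norm (f s) * B) \<longlongrightarrow> 0) ?F"
      using A_zeroD(3)[OF assms(1)] by (intro tendsto_mult_left_zero tendsto_norm_zero)
  qed
  then show ?thesis
    using A_zeroD[OF assms(1)] AP_plus_analytic[OF assms(2)]
    by (intro A_zeroI holomorphic_intros continuous_intros)
qed

lemma zero_in_A_zero: "(\<lambda>s\<in>closed_rhp. 0) \<in> A_zero"
  by (intro A_zeroI) auto

lemma A_zero_AP_plus_simps:
  "carrier A_zero_AP_plus = {(\<lambda>s\<in>closed_rhp. f s + g s) |f g. f \<in> A_zero \<and> g \<in> AP_plus}"
  "f \<otimes>\<^bsub>A_zero_AP_plus\<^esub> g = (\<lambda>s\<in>closed_rhp. f s * g s)"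
  "f \<oplus>\<^bsub>A_zero_AP_plus\<^esub> g = (\<lambda>s\<in>closed_rhp. f s + g s)"
  "\<one>\<^bsub>A_zero_AP_plus\<^esub> = (\<lambda>s\<in>closed_rhp. 1)"
  "\<zero>\<^bsub>A_zero_AP_plus\<^esub> = (\<lambda>s\<in>closed_rhp. 0)"
  by (simp_all add: A_zero_AP_plus_def)

lemma A_zero_AP_plus_carrierE:
  assumes "h \<in> carrier A_zero_AP_plus"
  obtains f g where "f \<in> A_zero" "g \<in> AP_plus" "h = (\<lambda>s\<in>closed_rhp. f s + g s)"
  using assms unfolding A_zero_AP_plus_simps by blast

lemma A_zero_AP_plus_carrierI:
  assumes "f \<in> A_zero" "g \<in> AP_plus" "\<And>s. s \<in> closed_rhp \<Longrightarrow> h s = f s + g s"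
    "h \<in> extensional closed_rhp"
  shows "h \<in> carrier A_zero_AP_plus"
proof -
  have "h = (\<lambda>s\<in>closed_rhp. f s + g s)"
    using assms(3,4) by (intro extensionalityI[of _ closed_rhp]) auto
  then show ?thesis using assms(1,2) unfolding A_zero_AP_plus_simps by blast
qed

lemma A_zero_AP_plus_carrierD:
  assumes "h \<in> carrier A_zero_AP_plus"
  shows "h \<in> extensional closed_rhp" "h holomorphic_on open_rhp" "continuous_on closed_rhp h"
proof -
  obtain f g where *: "f \<in> A_zero" "g \<in> AP_plus" "h = (\<lambda>s\<in>closed_rhp. f s + g s)"
    by (rule A_zero_AP_plus_carrierE[OF assms])
  have "(\<lambda>s. f s + g s) holomorphic_on open_rhp"
    using A_zeroD[OF *(1)] AP_plus_analytic[OF *(2)] by (intro holomorphic_intros)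
  then show "h holomorphic_on open_rhp"
    by (rule holomorphic_transform) (use open_rhp_subset in \<open>auto simp: *(3)\<close>)
  have "continuous_on closed_rhp (\<lambda>s. f s + g s)"
    using A_zeroD[OF *(1)] AP_plus_analytic[OF *(2)] by (intro continuous_intros)
  then show "continuous_on closed_rhp h"
    by (rule continuous_on_eq) (simp add: *(3))
  show "h \<in> extensional closed_rhp" by (simp add: *(3))
qed

lemma A_zero_AP_plus_const: "(\<lambda>s\<in>closed_rhp. a) \<in> carrier A_zero_AP_plus"
  by (rule A_zero_AP_plus_carrierI[OF zero_in_A_zero
        causal_exp_span_imp_AP_plus[OF causal_exp_span_const[of a]]]) auto

lemma A_zero_AP_plus_add:
  assumes "h \<in> carrier A_zero_AP_plus" "k \<in> carrier A_zero_AP_plus"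
  shows "(\<lambda>s\<in>closed_rhp. h s + k s) \<in> carrier A_zero_AP_plus"
proof -
  obtain f g where 1: "f \<in> A_zero" "g \<in> AP_plus" "h = (\<lambda>s\<in>closed_rhp. f s + g s)"
    by (rule A_zero_AP_plus_carrierE[OF assms(1)])
  obtain u v where 2: "u \<in> A_zero" "v \<in> AP_plus" "k = (\<lambda>s\<in>closed_rhp. u s + v s)"
    by (rule A_zero_AP_plus_carrierE[OF assms(2)])
  show ?thesis
    by (rule A_zero_AP_plus_carrierI[OF A_zero_add[OF 1(1) 2(1)] AP_plus_add[OF 1(2) 2(2)]])
       (auto simp: 1(3) 2(3))
qed

lemma A_zero_AP_plus_mult:
  assumes "h \<in> carrier A_zero_AP_plus" "k \<in> carrier A_zero_AP_plus"
  shows "(\<lambda>s\<in>closed_rhp. h s * k s) \<in> carrier A_zero_AP_plus"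
proof -
  obtain f g where 1: "f \<in> A_zero" "g \<in> AP_plus" "h = (\<lambda>s\<in>closed_rhp. f s + g s)"
    by (rule A_zero_AP_plus_carrierE[OF assms(1)])
  obtain u v where 2: "u \<in> A_zero" "v \<in> AP_plus" "k = (\<lambda>s\<in>closed_rhp. u s + v s)"
    by (rule A_zero_AP_plus_carrierE[OF assms(2)])
  show ?thesis
    by (rule A_zero_AP_plus_carrierI[OF
          A_zero_add[OF A_zero_add[OF A_zero_mult[OF 1(1) 2(1)] A_zero_mult_AP_plus[OF 1(1) 2(2)]]
            A_zero_mult_AP_plus[OF 2(1) 1(2)]]
          AP_plus_mult[OF 1(2) 2(2)]])
       (auto simp: 1(3) 2(3) algebra_simps)
qed

lemma A_zero_AP_plus_no_zero_divisors:
  assumes h: "h \<in> carrier A_zero_AP_plus" and k: "k \<in> carrier A_zero_AP_plus"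
    and hk: "\<And>s. s \<in> closed_rhp \<Longrightarrow> h s * k s = 0"
    and ne: "\<exists>s\<in>closed_rhp. h s \<noteq> 0" and s: "s \<in> closed_rhp"
  shows "k s = 0"
proof -
  have vanish: "\<forall>s\<in>closed_rhp. f s = 0"
    if f: "f \<in> carrier A_zero_AP_plus" and 0: "\<forall>s\<in>open_rhp. f s = 0" for f
  proof
    fix s assume s: "s \<in> closed_rhp"
    have "closure open_rhp \<subseteq> closed_rhp"
      by (rule closure_minimal[OF open_rhp_subset])
         (simp add: closed_rhp_def closed_halfspace_Re_ge)
    then have "continuous_on (closure open_rhp) f"
      using A_zero_AP_plus_carrierD(3)[OF f] continuous_on_subset by blast
    then show "f s = 0"
      using continuous_constant_on_closure[of open_rhp f 0 s] 0 s closed_rhp_subset_closure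
      by blast
  qed
  obtain z where z: "z \<in> open_rhp" "h z \<noteq> 0"
    using vanish[OF h] ne by blast
  have "continuous_on open_rhp h"
    using A_zero_AP_plus_carrierD(2)[OF h] holomorphic_on_imp_continuous_on by blast
  then have U: "open (open_rhp \<inter> h -` (-{0}))"
    by (rule continuous_open_preimage[OF _ open_open_rhp]) auto
  have "k w = 0" if "w \<in> open_rhp" for w
  proof (rule analytic_continuation[OF A_zero_AP_plus_carrierD(2)[OF k] open_open_rhp
          connected_open_rhp, of "open_rhp \<inter> h -` (-{0})" z])
    show "z islimpt open_rhp \<inter> h -` (- {0})"
      using interior_open[OF U] z by (intro interior_limit_point) (simp only:, blast)
    show "k x = 0" if "x \<in> open_rhp \<inter> h -` (- {0})" for x
      using that hk[of x] open_rhp_subset by auto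
  qed (use z that in auto)
  then show ?thesis using vanish[OF k] s by blast
qed

lemma domain_A_zero_AP_plus: "domain A_zero_AP_plus"
proof -
  note simps = A_zero_AP_plus_simps(2-5)
  note ext = A_zero_AP_plus_carrierD(1)
  have eqI: "f = g" if "f \<in> extensional closed_rhp" "g \<in> extensional closed_rhp"
      "\<And>s. s \<in> closed_rhp \<Longrightarrow> f s = g s" for f g :: "complex \<Rightarrow> complex"
    using that extensionalityI by blast
  have "cring A_zero_AP_plus"
  proof (rule cringI)
    show "abelian_group A_zero_AP_plus"
    proof (rule abelian_groupI)
      fix x assume x: "x \<in> carrier A_zero_AP_plus"
      show "\<exists>y\<in>carrier A_zero_AP_plus. y \<oplus>\<^bsub>A_zero_AP_plus\<^esub> x = \<zero>\<^bsub>A_zero_AP_plus\<^esub>"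
        using A_zero_AP_plus_mult[OF A_zero_AP_plus_const[of "-1"] x]
        by (intro bexI[rotated]) (auto simp: simps intro!: eqI)
    qed (auto simp: simps A_zero_AP_plus_add A_zero_AP_plus_const ext intro!: eqI)
    show "comm_monoid A_zero_AP_plus"
      by (rule comm_monoidI)
         (auto simp: simps A_zero_AP_plus_mult A_zero_AP_plus_const ext intro!: eqI)
  qed (auto simp: simps ext algebra_simps intro!: eqI)
  moreover have "domain_axioms A_zero_AP_plus"
  proof
    have "0 \<in> closed_rhp" by (simp add: closed_rhp_def)
    then show "\<one>\<^bsub>A_zero_AP_plus\<^esub> \<noteq> \<zero>\<^bsub>A_zero_AP_plus\<^esub>"
      unfolding simps by (metis restrict_apply' zero_neq_one)
  next
    fix a b
    assume *: "a \<otimes>\<^bsub>A_zero_AP_plus\<^esub> b = \<zero>\<^bsub>A_zero_AP_plus\<^esub>"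
      and a: "a \<in> carrier A_zero_AP_plus" and b: "b \<in> carrier A_zero_AP_plus"
    have "a s * b s = 0" if "s \<in> closed_rhp" for s
      using * that unfolding simps by (metis restrict_apply')
    then have "(\<forall>s\<in>closed_rhp. a s = 0) \<or> (\<forall>s\<in>closed_rhp. b s = 0)"
      using A_zero_AP_plus_no_zero_divisors[OF a b] by blast
    then show "a = \<zero>\<^bsub>A_zero_AP_plus\<^esub> \<or> b = \<zero>\<^bsub>A_zero_AP_plus\<^esub>"
      unfolding simps using ext[OF a] ext[OF b] by (auto intro!: eqI)
  qed
  ultimately show ?thesis by (rule domain.intro)
qed

end

theory Submission
  imports Defs
begin

text \<open>
  Let \<open>p(s) = s / (s + 1)\<close> and let \<open>S(s) = exp (- 1 / s)\<close> be the inner function whose only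
  singularity on the boundary is the zero \<open>0\<close> of \<open>p\<close>.  Both \<open>p\<close> and \<open>p S\<close> belong to the algebra,
  and the intersection of the principal ideals \<open>(p)\<close> and \<open>(p S)\<close> is not finitely generated.

  An element of the intersection has the form \<open>p f = p S g\<close>, so \<open>f = S g\<close> off \<open>0\<close>.  On the
  imaginary axis \<open>S\<close> is unimodular and oscillates infinitely often near \<open>0\<close>, so continuity of
  \<open>f\<close> and \<open>g\<close> forces \<open>g 0 = 0\<close> (\<open>mult_exp_neg_inverse_continuous_imp_zero\<close>).  Conversely, if
  \<open>g 0 = 0\<close>, then \<open>S g\<close> is continuous at \<open>0\<close>, and it lies in the algebra because \<open>S\<close> tends to \<open>1\<close>
  at infinity (\<open>mult_exp_neg_inverse_carrier\<close>).  The intersection is therefore \<open>p S M\<close>, where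
  \<open>M\<close> is the ideal of the functions vanishing at \<open>0\<close>.

  Finitely many generators \<open>p S g\<^sub>1, \<dots>, p S g\<^sub>n\<close> would make every \<open>f\<close> in \<open>M\<close> satisfy
  \<open>\<bar>f\<bar> \<le> C G\<close> on the real interval from \<open>0\<close> to \<open>1\<close>, where \<open>G = \<bar>g\<^sub>1\<bar> + \<dots> + \<bar>g\<^sub>n\<bar>\<close> tends to \<open>0\<close>
  at \<open>0\<close> (\<open>genideal_dominated\<close>).  But \<open>M\<close> contains functions that vanish at \<open>0\<close> as slowly as
  one likes: choose \<open>x\<^sub>k\<close> with \<open>G (x\<^sub>k) < 4\<^sup>-\<^sup>k\<close> and take the sum of the functions
  \<open>2\<^sup>-\<^sup>k s / (s + x\<^sub>k)\<close>, whose value at \<open>x\<^sub>k\<close> is at least \<open>2\<^sup>-\<^sup>k / 2\<close>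
  (\<open>exists_carrier_vanishing_slowly\<close>).
\<close>

section \<open>Multiplication by the singular inner function\<close>

lemma norm_exp_neg_inverse_le:
  assumes "s \<in> closed_rhp"
  shows "norm (exp (- 1 / s)) \<le> 1"
  using assms by (simp add: norm_exp_eq_Re closed_rhp_def Re_divide)

text \<open>
  The zero of \<open>h\<close> absorbs the bounded oscillation of \<open>exp (- 1 / s)\<close> at the origin.  At infinity
  \<open>exp (- 1 / s)\<close> tends to \<open>1\<close>, so multiplication by it changes \<open>h\<close> only by a function tending
  to \<open>0\<close>: the product has the same almost periodic part as \<open>h\<close>.
\<close>

lemma mult_exp_neg_inverse_carrier:
  assumes h: "h \<in> carrier A_zero_AP_plus" and h0: "h 0 = 0"
  shows "(\<lambda>s\<in>closed_rhp. h s * exp (- 1 / s)) \<in> carrier A_zero_AP_plus"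
proof -
  obtain f g where fg: "f \<in> A_zero" "g \<in> AP_plus" "h = (\<lambda>s\<in>closed_rhp. f s + g s)"
    by (rule A_zero_AP_plus_carrierE[OF h])
  let ?F = "inf at_infinity (principal closed_rhp)"
  let ?k = "\<lambda>s. h s * exp (- 1 / s)"
  have hol: "?k holomorphic_on open_rhp"
    using A_zero_AP_plus_carrierD(2)[OF h]
    by (intro holomorphic_intros) (auto simp: open_rhp_def)
  have cont: "continuous_on closed_rhp ?k"
    unfolding continuous_on_def
  proof
    fix z assume z: "z \<in> closed_rhp"
    have lim: "(h \<longlongrightarrow> h z) (at z within closed_rhp)"
      using A_zero_AP_plus_carrierD(3)[OF h] z unfolding continuous_on_def by blast
    show "(?k \<longlongrightarrow> ?k z) (at z within closed_rhp)"
    proof (cases "z = 0")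
      case True
      have "(?k \<longlongrightarrow> 0) (at 0 within closed_rhp)"
      proof (rule Lim_null_comparison)
        show "\<forall>\<^sub>F s in at 0 within closed_rhp. norm (?k s) \<le> norm (h s)"
          unfolding eventually_at_filter norm_mult
          by (intro always_eventually allI impI mult_left_le norm_exp_neg_inverse_le norm_ge_zero)
        show "((\<lambda>s. norm (h s)) \<longlongrightarrow> 0) (at 0 within closed_rhp)"
          using lim True h0 by (simp add: tendsto_norm_zero)
      qed
      then show ?thesis using True h0 by simp
    next
      case False
      then show ?thesis by (intro tendsto_intros lim) auto
    qed
  qed
  obtain B where B: "B > 0" "\<And>s. s \<in> closed_rhp \<Longrightarrow> norm (g s) \<le> B"
    using AP_plus_bounded[OF fg(2)] by blast
  have inv: "((\<lambda>s::complex. - 1 / s) \<longlongrightarrow> 0) ?F"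
    using tendsto_minus[OF tendsto_inverse_0]
    by (rule tendsto_mono[rotated, THEN filterlim_cong[THEN iffD1, rotated -1]])
       (auto simp: inverse_eq_divide)
  then have E: "((\<lambda>s::complex. exp (- 1 / s)) \<longlongrightarrow> 1) ?F"
    using tendsto_exp[OF inv] by simp
  have "((\<lambda>s. f s * exp (- 1 / s)) \<longlongrightarrow> 0) ?F"
    using tendsto_mult[OF A_zeroD(3)[OF fg(1)] E] by simp
  moreover have "((\<lambda>s. g s * (exp (- 1 / s) - 1)) \<longlongrightarrow> 0) ?F"
  proof (rule Lim_null_comparison)
    show "\<forall>\<^sub>F s in ?F. norm (g s * (exp (- 1 / s) - 1)) \<le> B * norm (exp (- 1 / s) - 1)"
      unfolding eventually_inf_principal
      by (intro always_eventually) (auto simp: norm_mult B mult_right_mono)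
    show "((\<lambda>s. B * norm (exp (- 1 / s :: complex) - 1)) \<longlongrightarrow> 0) ?F"
      using E by (intro tendsto_mult_right_zero tendsto_norm_zero) (simp add: LIM_zero)
  qed
  ultimately have sum: "((\<lambda>s. f s * exp (- 1 / s) + g s * (exp (- 1 / s) - 1)) \<longlongrightarrow> 0) ?F"
    by (rule tendsto_add_zero)
  have "((\<lambda>s. ?k s - g s) \<longlongrightarrow> 0) ?F"
    by (rule Lim_transform_eventually[OF sum])
       (auto simp: eventually_inf_principal fg(3) algebra_simps)
  then have "restrict (\<lambda>s. ?k s - g s) closed_rhp \<in> A_zero"
    using hol cont AP_plus_analytic[OF fg(2)]
    by (intro A_zeroI holomorphic_on_diff continuous_on_diff)
  then show ?thesis
    by (rule A_zero_AP_plus_carrierI[OF _ fg(2)]) auto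
qed

text \<open>
  Since \<open>exp (- 1 / s)\<close> takes each of the values \<open>1\<close> and \<open>- 1\<close> on a sequence of imaginary points
  converging to \<open>0\<close>, continuity gives both \<open>f 0 = g 0\<close> and \<open>f 0 = - g 0\<close>.
\<close>

lemma mult_exp_neg_inverse_continuous_imp_zero:
  assumes g: "continuous_on closed_rhp g" and f: "continuous_on closed_rhp f"
    and eq: "\<And>s. s \<in> closed_rhp - {0} \<Longrightarrow> f s = g s * exp (- 1 / s)"
  shows "g 0 = 0"
proof -
  have lim: "f 0 = g 0 * c"
    if c: "\<And>n. exp (\<i> * of_real (\<theta> n)) = c" and pos: "\<And>n. \<theta> n > 0"
      and top: "filterlim \<theta> at_top sequentially"
    for c :: complex and \<theta> :: "nat \<Rightarrow> real"
  proof -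
    \<comment> \<open>chosen such that \<open>- 1 / z n = \<i> * \<theta> n\<close>\<close>
    define z where "z n = \<i> * of_real (inverse (\<theta> n))" for n
    have zrhp: "z n \<in> closed_rhp - {0}" for n
      using pos[of n] by (auto simp: z_def closed_rhp_def)
    have "(\<lambda>n. inverse (\<theta> n)) \<longlonglongrightarrow> 0"
      using top by (intro tendsto_inverse_0_at_top)
    then have "z \<longlonglongrightarrow> \<i> * of_real 0"
      unfolding z_def by (intro tendsto_intros)
    then have z0: "z \<longlonglongrightarrow> 0" by simp
    have 0: "0 \<in> closed_rhp" by (simp add: closed_rhp_def)
    have "exp (- 1 / z n) = c" for n
      using c[of n] pos[of n] by (simp add: z_def field_simps)
    then have fz: "f (z n) = g (z n) * c" for n
      using eq[OF zrhp] by simp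
    have "(\<lambda>n. f (z n)) \<longlonglongrightarrow> f 0"
      using zrhp by (intro continuous_on_tendsto_compose[OF f z0 0] always_eventually) auto
    moreover have "(\<lambda>n. g (z n) * c) \<longlonglongrightarrow> g 0 * c"
      using zrhp by (intro tendsto_intros continuous_on_tendsto_compose[OF g z0 0] always_eventually) auto
    ultimately show ?thesis unfolding fz by (rule LIMSEQ_unique)
  qed
  have top: "filterlim (\<lambda>n. 2 * pi * real (Suc n) + a) at_top sequentially" if "a \<ge> 0" for a
  proof (rule filterlim_at_top_mono[OF filterlim_real_sequentially], intro always_eventually allI)
    fix n
    have "1 * real n \<le> 2 * pi * real (Suc n)"
      using pi_gt3 by (intro mult_mono) auto
    then show "real n \<le> 2 * pi * real (Suc n) + a" using that by simp
  qed
  have "f 0 = g 0 * 1"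
  proof (rule lim[OF _ _ top[of 0, OF order_refl]])
    show "exp (\<i> * complex_of_real (2 * pi * real (Suc n) + 0)) = 1" for n
      by (subst exp_eq_1) (auto simp: intro!: exI[of _ "int (Suc n)"])
  qed (simp add: add_pos_nonneg)
  moreover have "f 0 = g 0 * (- 1)"
  proof (rule lim[OF _ _ top[of pi, OF pi_ge_zero]])
    fix n
    have "exp (\<i> * complex_of_real (2 * pi * real (Suc n) + pi)) =
        exp (\<i> * complex_of_real (2 * pi * real (Suc n))) * exp (\<i> * pi)"
      by (simp only: of_real_add distrib_left exp_add)
    also have "exp (\<i> * complex_of_real (2 * pi * real (Suc n))) = 1"
      by (subst exp_eq_1) (auto simp: intro!: exI[of _ "int (Suc n)"])
    finally show "exp (\<i> * complex_of_real (2 * pi * real (Suc n) + pi)) = - 1"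
      by simp
  qed (simp add: add_pos_nonneg)
  ultimately show ?thesis by simp
qed

section \<open>Functions vanishing slowly at the origin\<close>

lemma norm_add_of_real_ge:
  assumes "s \<in> closed_rhp" "x \<ge> 0"
  shows "norm (s + of_real x) \<ge> norm s" "norm (s + of_real x) \<ge> x"
proof -
  have "(Re s)\<^sup>2 \<le> (Re s + x)\<^sup>2"
    using assms by (intro power_mono) (auto simp: closed_rhp_def)
  then show "norm (s + of_real x) \<ge> norm s" by (simp add: cmod_def)
  have "x \<le> Re (s + of_real x)" using assms by (simp add: closed_rhp_def)
  then show "norm (s + of_real x) \<ge> x" using complex_Re_le_cmod order_trans by blast
qed

text \<open>
  The function is the sum of \<open>2\<^sup>-\<^sup>k s / (s + x\<^sub>k)\<close> over all \<open>k\<close>.  At a positive real point all terms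
  are positive, and the term of index \<open>k\<close> equals \<open>2\<^sup>-\<^sup>k / 2\<close> at \<open>x\<^sub>k\<close>, so the other terms cannot
  cancel it.
\<close>

lemma exists_carrier_vanishing_sequence_bound:
  fixes x :: "nat \<Rightarrow> real"
  assumes x: "\<And>k. x k \<in> {0<..1}"
  obtains f where "f \<in> carrier A_zero_AP_plus" "f 0 = 0"
    "\<And>k. (1/2) ^ k / 2 \<le> norm (f (of_real (x k)))"
proof -
  \<comment> \<open>As \<open>s / (s + x k) = 1 - x k / (s + x k)\<close>, the sum is \<open>2 - h\<close>, which splits it into its
    almost periodic part \<open>2\<close> and a part that decays at infinity.\<close>
  define u where "u k s = (1/2) ^ k * of_real (x k) / (s + of_real (x k))" for k and s :: complex
  define h where "h s = (\<Sum>k. u k s)" for s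
  have ne: "s + of_real (x k) \<noteq> 0" if "s \<in> closed_rhp" for s k
  proof
    assume "s + of_real (x k) = 0"
    then have "Re (s + of_real (x k)) = 0" by simp
    then show False using that x[of k] by (simp add: closed_rhp_def)
  qed
  have geo: "summable (\<lambda>k. (1/2::real) ^ k)" "(\<Sum>k. (1/2::real) ^ k) = 2"
    by (simp_all add: suminf_geometric)
  have norm_u: "norm (u k s) = (1/2) ^ k * (x k / norm (s + of_real (x k)))" for k s
    unfolding u_def norm_mult norm_divide norm_power norm_of_real using x[of k] by simp
  have u1: "norm (u k s) \<le> (1/2) ^ k" if "s \<in> closed_rhp" for k s
  proof -
    have "x k / norm (s + of_real (x k)) \<le> 1"
      using x[of k] norm_add_of_real_ge(2)[OF that, of "x k"]
      by (intro divide_le_eq_1_pos[THEN iffD2]) auto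
    then show ?thesis unfolding norm_u by (intro mult_left_le) simp_all
  qed
  have u2: "norm (u k s) \<le> (1/2) ^ k * inverse (norm s)" if "s \<in> closed_rhp" "s \<noteq> 0" for k s
  proof -
    have "x k / norm (s + of_real (x k)) \<le> 1 / norm s"
      using x[of k] norm_add_of_real_ge(1)[OF that(1), of "x k"] that(2)
      by (intro frac_le) auto
    then show ?thesis
      unfolding norm_u inverse_eq_divide by (intro mult_left_mono) simp_all
  qed
  have sums: "summable (\<lambda>k. u k s)" if "s \<in> closed_rhp" for s
    by (rule summable_comparison_test'[OF geo(1), of 0]) (use u1[OF that] in auto)
  have unif: "uniform_limit closed_rhp (\<lambda>n s. \<Sum>k<n. u k s) h sequentially"
    unfolding h_def by (rule Weierstrass_m_test[OF u1 geo(1)])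
  have u_cont: "continuous_on closed_rhp (\<lambda>s. \<Sum>k<n. u k s)" for n
    unfolding u_def by (intro continuous_intros) (use ne in auto)
  have u_hol: "(\<lambda>s. \<Sum>k<n. u k s) holomorphic_on open_rhp" for n
    unfolding u_def by (intro holomorphic_intros) (use ne open_rhp_subset in auto)
  have h_cont: "continuous_on closed_rhp h"
    by (rule uniform_limit_theorem[OF _ unif]) (use u_cont in auto)
  have h_hol: "h holomorphic_on open_rhp"
  proof (rule holomorphic_uniform_sequence[OF open_open_rhp u_hol])
    show "\<exists>d>0. cball z d \<subseteq> open_rhp \<and>
        uniform_limit (cball z d) (\<lambda>n s. \<Sum>k<n. u k s) h sequentially"
      if "z \<in> open_rhp" for z
      using that open_open_rhp open_rhp_subset uniform_limit_on_subset[OF unif]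
      by (meson open_contains_cball order_trans)
  qed
  have h_lim: "(h \<longlongrightarrow> 0) (inf at_infinity (principal closed_rhp))"
  proof (rule Lim_null_comparison)
    have "norm (h s) \<le> 2 * inverse (norm s)" if s: "s \<in> closed_rhp" "s \<noteq> 0" for s
    proof -
      have "norm (h s) \<le> (\<Sum>k. (1/2) ^ k * inverse (norm s))"
        unfolding h_def by (rule norm_suminf_le[OF u2[OF s] summable_mult2[OF geo(1)]])
      then show ?thesis using geo by (simp add: suminf_mult2[symmetric])
    qed
    then show "\<forall>\<^sub>F s in inf at_infinity (principal closed_rhp). norm (h s) \<le> 2 * inverse (norm s)"
      unfolding eventually_inf_principal
      by (intro eventually_mono[OF eventually_not_equal_at_infinity[of 0]]) auto
    have "((\<lambda>s::complex. 2 * inverse (norm s)) \<longlongrightarrow> 0) at_infinity"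
      by (intro tendsto_mult_right_zero tendsto_inverse_0_at_top filterlim_norm_at_top)
    then show "((\<lambda>s::complex. 2 * inverse (norm s)) \<longlongrightarrow> 0) (inf at_infinity (principal closed_rhp))"
      by (rule tendsto_mono[rotated]) simp
  qed
  define f where "f = (\<lambda>s\<in>closed_rhp. 2 - h s)"
  have "f \<in> carrier A_zero_AP_plus"
  proof (rule A_zero_AP_plus_carrierI)
    have "((\<lambda>s. - h s) \<longlongrightarrow> 0) (inf at_infinity (principal closed_rhp))"
      using tendsto_minus[OF h_lim] by simp
    then show "restrict (\<lambda>s. - h s) closed_rhp \<in> A_zero"
      using h_cont h_hol by (intro A_zeroI holomorphic_intros continuous_intros)
    show "(\<lambda>s\<in>closed_rhp. 2) \<in> AP_plus"
      by (intro causal_exp_span_imp_AP_plus causal_exp_span_const)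
  qed (auto simp: f_def)
  moreover have "f 0 = 0"
  proof -
    have "u k 0 = of_real ((1/2) ^ k)" for k
      using x[of k] by (simp add: u_def)
    then have "h 0 = of_real (\<Sum>k. (1/2) ^ k)"
      unfolding h_def by (simp only: suminf_of_real[OF geo(1)])
    then show ?thesis using geo(2) by (simp add: f_def closed_rhp_def)
  qed
  moreover have "(1/2) ^ k / 2 \<le> norm (f (of_real (x k)))" for k
  proof -
    have xk: "x k > 0" using x[of k] by simp
    let ?y = "complex_of_real (x k)"
    have y: "?y \<in> closed_rhp" using xk by (simp add: closed_rhp_def)
    define v where "v j = (1/2) ^ j * (x k / (x k + x j))" for j
    have v: "complex_of_real (v j) = of_real ((1/2)^j) - u j ?y" for j
    proof -
      have "x k + x j \<noteq> 0" using xk x[of j] by auto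
      then have "x k / (x k + x j) = 1 - x j / (x k + x j)"
        by (simp add: field_simps)
      then have "v j = (1/2)^j - (1/2)^j * x j / (x k + x j)"
        unfolding v_def by (simp only: right_diff_distrib mult_1_right times_divide_eq_right)
      then show ?thesis by (simp add: u_def)
    qed
    have vsums: "summable v"
    proof -
      have "summable (\<lambda>j. complex_of_real ((1/2)^j) - u j ?y)"
        using sums[OF y] geo(1) by (intro summable_diff summable_of_real)
      then have "summable (\<lambda>j. complex_of_real (v j))" unfolding v .
      then show ?thesis by (simp only: summable_of_real_iff)
    qed
    have "complex_of_real (\<Sum>j. v j) = (\<Sum>j. of_real ((1/2)^j) - u j ?y)"
      unfolding v[symmetric] using vsums by (rule suminf_of_real)
    also have "\<dots> = (\<Sum>j. of_real ((1/2)^j)) - h ?y"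
      unfolding h_def by (rule suminf_diff[symmetric]) (use sums[OF y] geo(1) summable_of_real in auto)
    also have "(\<Sum>j. complex_of_real ((1/2)^j)) = 2"
      by (subst suminf_of_real[OF geo(1), symmetric]) (simp add: geo(2))
    finally have fy: "f ?y = of_real (\<Sum>j. v j)" using y by (simp add: f_def)
    have vnn: "v j \<ge> 0" for j using xk x[of j] by (simp add: v_def)
    have "(1/2) ^ k / 2 = v k" using xk by (simp add: v_def field_simps)
    also have "v k \<le> (\<Sum>j. v j)"
      using sum_le_suminf[OF vsums, of "{k}"] vnn by auto
    also have "\<dots> \<le> norm (f ?y)" unfolding fy norm_of_real by simp
    finally show ?thesis .
  qed
  ultimately show ?thesis using that by blast
qed

text \<open>
  Along points \<open>x\<^sub>k\<close> where \<open>\<bar>G\<bar>\<close> is below \<open>4\<^sup>-\<^sup>k\<close>, a function of size at least \<open>2\<^sup>-\<^sup>k / 2\<close> outgrows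
  every multiple of \<open>G\<close>.
\<close>

lemma exists_carrier_vanishing_slowly:
  fixes G :: "real \<Rightarrow> real"
  assumes G: "(G \<longlongrightarrow> 0) (at_right 0)"
  obtains f where "f \<in> carrier A_zero_AP_plus" "f 0 = 0"
    "\<And>C. \<exists>x\<in>{0<..1}. C * G x < norm (f (of_real x))"
proof -
  have "\<exists>x\<in>{0<..1}. \<bar>G x\<bar> < (1/4) ^ k" for k :: nat
  proof -
    have "\<forall>\<^sub>F x in at_right 0. \<bar>G x\<bar> < (1/4) ^ k"
      using tendstoD[OF G, of "(1/4)^k"] by simp
    moreover have "\<forall>\<^sub>F x in at_right (0::real). x \<in> {0<..1}"
      unfolding eventually_at_right_field by (auto intro!: exI[of _ 1])
    ultimately have "\<forall>\<^sub>F x in at_right 0. x \<in> {0<..1} \<and> \<bar>G x\<bar> < (1/4) ^ k"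
      by eventually_elim auto
    then show ?thesis
      using eventually_happens'[OF trivial_limit_at_right_real] by blast
  qed
  then obtain x where x: "\<And>k. x k \<in> {0<..1}" "\<And>k. \<bar>G (x k)\<bar> < (1/4) ^ k"
    by metis
  obtain f where f: "f \<in> carrier A_zero_AP_plus" "f 0 = 0"
    "\<And>k. (1/2) ^ k / 2 \<le> norm (f (of_real (x k)))"
    using x(1) by (rule exists_carrier_vanishing_sequence_bound) (rule that)
  have "\<exists>y\<in>{0<..1}. C * G y < norm (f (of_real y))" for C
  proof -
    obtain k where k: "2 * \<bar>C\<bar> < 2 ^ k"
      using real_arch_pow[of 2 "2 * \<bar>C\<bar>"] by auto
    have "C * G (x k) \<le> \<bar>C\<bar> * \<bar>G (x k)\<bar>"
      unfolding abs_mult[symmetric] by (rule abs_ge_self)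
    also have "\<dots> \<le> \<bar>C\<bar> * (1/4) ^ k"
      using less_imp_le[OF x(2)] by (intro mult_left_mono abs_ge_zero)
    also have "\<dots> < 2 ^ k / 2 * (1/4) ^ k"
      using k by (intro mult_strict_right_mono) auto
    also have "\<dots> = (1/2) ^ k / 2"
      by (simp add: power_mult_distrib[symmetric] power_divide[symmetric] field_simps)
    finally show ?thesis using f(3)[of k] x(1)[of k] by (intro bexI[of _ "x k"]) auto
  qed
  then show ?thesis using that f(1,2) by blast
qed

section \<open>Domination by generators\<close>

text \<open>
  The elements admitting such a bound for some constant form an ideal containing \<open>A\<close>, because elements
  of the algebra are bounded on the compact real interval from \<open>0\<close> to \<open>1\<close>.
\<close>

lemma genideal_dominated:
  assumes A: "A \<subseteq> carrier A_zero_AP_plus" "finite A" and h: "h \<in> genideal A_zero_AP_plus A"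
  obtains C where "\<And>x. x \<in> {0<..1} \<Longrightarrow> norm (h (of_real x)) \<le> C * (\<Sum>a\<in>A. norm (a (of_real x)))"
proof -
  interpret R: domain A_zero_AP_plus by (rule domain_A_zero_AP_plus)
  note simps = A_zero_AP_plus_simps(2-5)
  let ?G = "\<lambda>x. \<Sum>a\<in>A. norm (a (complex_of_real x))"
  define K where "K = {h \<in> carrier A_zero_AP_plus.
     \<exists>C. \<forall>x\<in>{0<..1}. norm (h (of_real x)) \<le> C * ?G x}"
  have rhp: "complex_of_real x \<in> closed_rhp" if "x \<in> {0<..1}" for x
    using that by (simp add: closed_rhp_def)
  have mult: "r \<otimes>\<^bsub>A_zero_AP_plus\<^esub> k \<in> K"
    if r: "r \<in> carrier A_zero_AP_plus" and k: "k \<in> K" for r k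
  proof -
    from k obtain C where C: "\<forall>x\<in>{0<..1}. norm (k (of_real x)) \<le> C * ?G x"
      unfolding K_def by blast
    have "compact (complex_of_real ` {0..1})"
      by (intro compact_continuous_image continuous_intros compact_Icc)
    moreover have "continuous_on (complex_of_real ` {0..1}) r"
      by (rule continuous_on_subset[OF A_zero_AP_plus_carrierD(3)[OF r]])
         (auto simp: closed_rhp_def)
    ultimately have "bounded (r ` complex_of_real ` {0..1})"
      using compact_continuous_image compact_imp_bounded by blast
    then obtain B where B: "\<And>x. x \<in> {0..1} \<Longrightarrow> norm (r (of_real x)) \<le> B"
      unfolding bounded_iff by blast
    have "norm (r (of_real x) * k (of_real x)) \<le> (B * C) * ?G x" if "x \<in> {0<..1}" for x
    proof -
      have "norm (r (of_real x)) * norm (k (of_real x)) \<le> B * (C * ?G x)"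
        using that B[of x] C by (intro mult_mono') auto
      then show ?thesis by (simp add: norm_mult mult.assoc)
    qed
    then have "\<exists>C. \<forall>x\<in>{0<..1}.
        norm ((r \<otimes>\<^bsub>A_zero_AP_plus\<^esub> k) (of_real x)) \<le> C * ?G x"
      using rhp by (auto simp: simps intro!: exI[of _ "B * C"])
    then show ?thesis using r k by (auto simp: K_def)
  qed
  have "ideal K A_zero_AP_plus"
  proof (rule idealI[OF R.ring_axioms])
    show "subgroup K (add_monoid A_zero_AP_plus)"
    proof (rule R.add.subgroupI)
      show "K \<subseteq> carrier A_zero_AP_plus" by (auto simp: K_def)
      have "\<zero>\<^bsub>A_zero_AP_plus\<^esub> \<in> K"
        using rhp by (auto simp: K_def simps intro!: exI[of _ 0] A_zero_AP_plus_const)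
      then show "K \<noteq> {}" by blast
    next
      fix k assume k: "k \<in> K"
      then have "k \<in> carrier A_zero_AP_plus" by (simp add: K_def)
      then have "\<ominus>\<^bsub>A_zero_AP_plus\<^esub> k =
          (\<ominus>\<^bsub>A_zero_AP_plus\<^esub> \<one>\<^bsub>A_zero_AP_plus\<^esub>) \<otimes>\<^bsub>A_zero_AP_plus\<^esub> k"
        by (simp add: R.l_minus)
      then show "\<ominus>\<^bsub>A_zero_AP_plus\<^esub> k \<in> K" using mult[OF _ k] by simp
    next
      fix k l assume kl: "k \<in> K" "l \<in> K"
      then obtain C D where CD: "\<forall>x\<in>{0<..1}. norm (k (of_real x)) \<le> C * ?G x"
        "\<forall>x\<in>{0<..1}. norm (l (of_real x)) \<le> D * ?G x"
        unfolding K_def by blast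
      have "norm (k (of_real x) + l (of_real x)) \<le> (C + D) * ?G x" if "x \<in> {0<..1}" for x
        unfolding distrib_right using CD that by (intro norm_triangle_le add_mono) auto
      then have "\<exists>C. \<forall>x\<in>{0<..1}.
          norm ((k \<oplus>\<^bsub>A_zero_AP_plus\<^esub> l) (of_real x)) \<le> C * ?G x"
        using rhp by (auto simp: simps intro!: exI[of _ "C + D"])
      then show "k \<oplus>\<^bsub>A_zero_AP_plus\<^esub> l \<in> K"
        using kl by (auto simp: K_def)
    qed
  next
    fix k r assume "k \<in> K" "r \<in> carrier A_zero_AP_plus"
    then show "r \<otimes>\<^bsub>A_zero_AP_plus\<^esub> k \<in> K" "k \<otimes>\<^bsub>A_zero_AP_plus\<^esub> r \<in> K"
      using mult R.m_comm[of k r] by (auto simp: K_def)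
  qed
  moreover have "A \<subseteq> K"
  proof
    fix a assume a: "a \<in> A"
    have "norm (a (of_real x)) \<le> 1 * ?G x" for x
      using member_le_sum[OF a, of "\<lambda>a. norm (a (of_real x))"] A(2) by simp
    then show "a \<in> K" using A a unfolding K_def by blast
  qed
  ultimately have "genideal A_zero_AP_plus A \<subseteq> K"
    by (rule R.genideal_minimal)
  then show ?thesis using h that unfolding K_def by blast
qed

section \<open>Principal ideals with infinitely generated intersection\<close>

theorem theorem8p3:
  shows "\<not> coherent_ring A_zero_AP_plus"
proof
  assume coh: "coherent_ring A_zero_AP_plus"
  interpret R: domain A_zero_AP_plus by (rule domain_A_zero_AP_plus)
  note simps = A_zero_AP_plus_simps(2-5)
  define p where "p = (\<lambda>s\<in>closed_rhp. s / (s + 1) :: complex)"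
  define q where "q = (\<lambda>s\<in>closed_rhp. p s * exp (- 1 / s))"
  have ne: "s + 1 \<noteq> 0" if "s \<in> closed_rhp" for s :: complex
    using norm_add_of_real_ge(2)[OF that, of 1] by auto
  have p: "p \<in> carrier A_zero_AP_plus"
  proof (rule A_zero_AP_plus_carrierI)
    have "((\<lambda>s::complex. - inverse (s + 1)) \<longlongrightarrow> - 0) at_infinity"
      by (intro tendsto_minus filterlim_compose[OF tendsto_inverse_0]
            tendsto_add_filterlim_at_infinity'[OF filterlim_ident tendsto_const])
    then have "((\<lambda>s::complex. - inverse (s + 1)) \<longlongrightarrow> 0) (inf at_infinity (principal closed_rhp))"
      by (simp add: tendsto_mono[OF inf_le1])
    then show "restrict (\<lambda>s. - inverse (s + 1)) closed_rhp \<in> A_zero"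
      using ne open_rhp_subset by (intro A_zeroI holomorphic_intros continuous_intros) auto
    show "(\<lambda>s\<in>closed_rhp. 1) \<in> AP_plus"
      by (intro causal_exp_span_imp_AP_plus causal_exp_span_const)
  qed (use ne in \<open>auto simp: p_def field_simps\<close>)
  have p0: "p 0 = 0" by (simp add: p_def closed_rhp_def)
  have pne: "p s \<noteq> 0" if "s \<in> closed_rhp - {0}" for s
    using that ne[of s] by (simp add: p_def)
  have q: "q \<in> carrier A_zero_AP_plus"
    unfolding q_def by (rule mult_exp_neg_inverse_carrier[of p, OF p p0])
  let ?I = "genideal A_zero_AP_plus {p}" and ?J = "genideal A_zero_AP_plus {q}"
  have "fin_gen_ideal ?I A_zero_AP_plus" "fin_gen_ideal ?J A_zero_AP_plus"
    unfolding fin_gen_ideal_def using p q R.genideal_ideal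
    by (metis empty_subsetI finite.emptyI finite.insertI insert_subset)+
  then have "fin_gen_ideal (?I \<inter> ?J) A_zero_AP_plus"
    using coh unfolding coherent_ring_def by blast
  then obtain A where A: "A \<subseteq> carrier A_zero_AP_plus" "finite A"
    "?I \<inter> ?J = genideal A_zero_AP_plus A"
    unfolding fin_gen_ideal_def by blast
  have mem: "h \<in> genideal A_zero_AP_plus {c} \<longleftrightarrow>
      (\<exists>r\<in>carrier A_zero_AP_plus. h = r \<otimes>\<^bsub>A_zero_AP_plus\<^esub> c)"
    if "c \<in> carrier A_zero_AP_plus" for c h
    using that by (auto simp: R.cgenideal_eq_genideal[symmetric] cgenideal_def)
  have "\<exists>g\<in>carrier A_zero_AP_plus. g 0 = 0 \<and> a = g \<otimes>\<^bsub>A_zero_AP_plus\<^esub> q" if a: "a \<in> A" for a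
  proof -
    have "a \<in> ?I" "a \<in> ?J" using A R.genideal_self[OF A(1)] a by auto
    then obtain f g where fg: "f \<in> carrier A_zero_AP_plus" "g \<in> carrier A_zero_AP_plus"
      "a = f \<otimes>\<^bsub>A_zero_AP_plus\<^esub> p" "a = g \<otimes>\<^bsub>A_zero_AP_plus\<^esub> q"
      unfolding mem[OF p] mem[OF q] by blast
    have "f s = g s * exp (- 1 / s)" if s: "s \<in> closed_rhp - {0}" for s
    proof -
      have "f s * p s = g s * q s"
        using fg(3,4) s unfolding simps by (metis DiffD1 restrict_apply')
      then show ?thesis using pne[OF s] s by (simp add: q_def)
    qed
    then have "g 0 = 0"
      using mult_exp_neg_inverse_continuous_imp_zero A_zero_AP_plus_carrierD(3) fg(1,2) by blast
    then show ?thesis using fg by blast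
  qed
  then obtain g where g: "\<And>a. a \<in> A \<Longrightarrow> g a \<in> carrier A_zero_AP_plus"
    "\<And>a. a \<in> A \<Longrightarrow> g a 0 = 0" "\<And>a. a \<in> A \<Longrightarrow> a = g a \<otimes>\<^bsub>A_zero_AP_plus\<^esub> q"
    by metis
  define G where "G x = (\<Sum>a\<in>A. norm (g a (complex_of_real x)))" for x :: real
  have "(G \<longlongrightarrow> (\<Sum>a\<in>A. norm (0::complex))) (at_right 0)"
    unfolding G_def
  proof (intro tendsto_sum tendsto_norm)
    fix a assume a: "a \<in> A"
    have "continuous_on {0..1} (\<lambda>x. g a (complex_of_real x))"
      by (rule continuous_on_compose2[OF A_zero_AP_plus_carrierD(3)[OF g(1)[OF a]]])
         (auto intro!: continuous_intros simp: closed_rhp_def)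
    then have "((\<lambda>x. g a (complex_of_real x)) \<longlongrightarrow> g a (complex_of_real 0)) (at_right 0)"
      by (rule continuous_on_Icc_at_rightD) simp
    then show "((\<lambda>x. g a (complex_of_real x)) \<longlongrightarrow> 0) (at_right 0)"
      using g(2)[OF a] by simp
  qed
  then have "(G \<longlongrightarrow> 0) (at_right 0)" by simp
  then obtain f where f: "f \<in> carrier A_zero_AP_plus" "f 0 = 0"
    "\<And>C. \<exists>x\<in>{0<..1}. C * G x < norm (f (of_real x))"
    by (rule exists_carrier_vanishing_slowly) blast
  define k where "k = (\<lambda>s\<in>closed_rhp. f s * exp (- 1 / s))"
  have k: "k \<in> carrier A_zero_AP_plus"
    unfolding k_def by (rule mult_exp_neg_inverse_carrier[OF f(1,2)])
  \<comment> \<open>As \<open>f\<close> vanishes at \<open>0\<close>, its product with \<open>q\<close> is also a multiple of \<open>p\<close>.\<close>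
  have "f \<otimes>\<^bsub>A_zero_AP_plus\<^esub> q = k \<otimes>\<^bsub>A_zero_AP_plus\<^esub> p"
    by (auto simp: simps k_def q_def)
  then have "f \<otimes>\<^bsub>A_zero_AP_plus\<^esub> q \<in> ?I \<inter> ?J"
    using f(1) k mem[OF p] mem[OF q] by (metis IntI)
  then obtain C where C: "\<And>x. x \<in> {0<..1} \<Longrightarrow>
      norm ((f \<otimes>\<^bsub>A_zero_AP_plus\<^esub> q) (of_real x)) \<le> C * (\<Sum>a\<in>A. norm (a (of_real x)))"
    using genideal_dominated[OF A(1,2)] A(3) by metis
  obtain x where x: "x \<in> {0<..1}" "C * G x < norm (f (of_real x))"
    using f(3) by blast
  have rhp: "complex_of_real x \<in> closed_rhp - {0}" using x(1) by (simp add: closed_rhp_def)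
  have "(\<Sum>a\<in>A. norm (a (complex_of_real x))) = G x * norm (q (of_real x))"
    unfolding G_def sum_distrib_right
  proof (rule sum.cong[OF refl])
    fix a assume a: "a \<in> A"
    have "a (complex_of_real x) = g a (of_real x) * q (of_real x)"
      using rhp g(3)[OF a] unfolding simps by (metis DiffD1 restrict_apply')
    then show "norm (a (complex_of_real x)) = norm (g a (of_real x)) * norm (q (of_real x))"
      by (simp add: norm_mult)
  qed
  then have "norm (f (of_real x)) * norm (q (of_real x)) \<le> C * G x * norm (q (of_real x))"
    using C[OF x(1)] rhp by (simp add: simps norm_mult)
  moreover have "norm (q (of_real x)) > 0"
    using pne[OF rhp] rhp by (simp add: q_def)
  ultimately show False using x(2) by simp
qed

end
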